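(* Consider a causal model without unobserved nodes over a finite set $S$ of random variables, given by structural equations, with causal structure $\mathcal G$. Then $\mathcal G$ can be entirely reconstructed from the complete set of (irreducible) unconditional affects relations holding in the model, i.e. those of the form $X\models Y\mid\mathrm{do}(Z)$ with $X,Y,Z\subseteq S$ pairwise disjoint and $X,Y$ non-empty. Moreover, the affects relations of this form with $|X|=|Y|=1$ suffice. (That is: two such models over $S$ for which exactly the same affects relations $X\models Y\mid\mathrm{do}(Z)$ with $|X|=|Y|=1$ hold have the same causal structure $\mathcal G$.)
   Context: The causal structure is a directed graph $\mathcal G$ (possibly cyclic) with node set $S$, all nodes being observed (discrete) random variables; $\mathrm{par}(Y)$ is the set of $N\in S$ with an edge $N\to Y$ (no node is its own parent). The model is given by structural equations: each non-exogenous node $Y$ (i.e. with $\mathrm{par}(Y)\ne\emptyset$) is given by a stochastic map (classical channel) $Y=f_Y(\mathrm{par}(Y))$, where no proper subset of $\mathrm{par}(Y)$ suffices as argument of $f_Y$ to give the same probability distribution (so $f_Y$ genuinely depends on each parent; in particular $f_Y$ is not constant). In the cyclic case the structural equations are required to be mutually consistent. Interventions: for $Z\subseteq S$, $\mathcal G_{\mathrm{do}(Z)}$ is obtained by deleting all edges into $Z$ and letting each element of $Z$ be set freely to an arbitrary chosen value by an exogenous intervention variable, keeping the maps $f_Y$ for $Y\notin Z$; the resulting distribution is $P_{\mathcal G_{\mathrm{do}(Z)}}(\cdot\mid Z=z)$. In particular, if $\mathrm{par}(Y)\subseteq Z\not\ni Y$, then under this intervention $Y$ is distributed as $f_Y$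 evaluated at the enforced values of $\mathrm{par}(Y)$. All distributions are compatible with their graphs via d-separation: d-separation of observed sets (including intervention variables) implies the corresponding conditional independence; in particular intervening on a set does not change the distribution of nodes which are not descendants of it. Affects relations: for pairwise disjoint $X,Y,Z\subseteq S$ with $X,Y$ non-empty, $X\models Y\mid\mathrm{do}(Z)$ holds if there exist values $x,z$ with $P_{\mathcal G_{\mathrm{do}(X\cup Z)}}(Y| X=x,Z=z)\neq P_{\mathcal G_{\mathrm{do}(Z)}}(Y| Z=z)$. It is irreducible if $s_X\models Y\mid\mathrm{do}(Z\cup(X\setminus s_X))$ for every non-empty $s_X\subsetneq X$ (automatic when $|X|=1$). *)

theory Defs
  imports "HOL-Probability.Probability"
begin

section \<open>Structural causal models, possibly cyclic, without unobserved nodes\<close>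

text \<open>
  An assignment of values to a set \<open>A\<close> of nodes is an element of \<open>PiE A V\<close>, where \<open>V i\<close> is the set of
  values of node \<open>i\<close>. The channel of a node is applied to assignments of its parents. For an
  exogenous node the only such assignment is the empty one, \<open>\<lambda>_. undefined\<close>, and the channel applied
  to it is just the distribution of the node.

  \<open>dist M Z z\<close> is the distribution of all nodes in the causal structure in which the edges into \<open>Z\<close>
  are removed, given that \<open>Z\<close> is set to \<open>z\<close>. It is part of the data because the structural equations
  of a cyclic model may have several solutions.
\<close>

record ('n, 'v) causal_model =
  nodes :: "'n set"
  edges :: "('n \<times> 'n) set"
  vals :: "'n \<Rightarrow> 'v set"
  chan :: "'n \<Rightarrow> ('n \<Rightarrow> 'v) \<Rightarrow> 'v pmf"
  dist :: "'n set \<Rightarrow> ('n \<Rightarrow> 'v) \<Rightarrow> ('n \<Rightarrow> 'v) pmf"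

definition par :: "('n, 'v) causal_model \<Rightarrow> 'n \<Rightarrow> 'n set" where
  "par M Y = {N. (N, Y) \<in> edges M}"

abbreviation assigns :: "('n, 'v) causal_model \<Rightarrow> 'n set \<Rightarrow> ('n \<Rightarrow> 'v) set" where
  "assigns M A \<equiv> PiE A (vals M)"

definition well_formed :: "('n, 'v) causal_model \<Rightarrow> bool" where
  "well_formed M \<longleftrightarrow>
     finite (nodes M) \<and> edges M \<subseteq> nodes M \<times> nodes M \<and> irrefl (edges M) \<and>
     (\<forall>i\<in>nodes M. countable (vals M i) \<and> vals M i \<noteq> {}) \<and>
     (\<forall>Y\<in>nodes M. \<forall>p\<in>assigns M (par M Y). set_pmf (chan M Y p) \<subseteq> vals M Y)"

definition genuine_parents :: "('n, 'v) causal_model \<Rightarrow> bool" where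
  "genuine_parents M \<longleftrightarrow>
     (\<forall>Y\<in>nodes M. \<forall>Q. Q \<subset> par M Y \<longrightarrow>
        \<not> (\<exists>h. \<forall>p\<in>assigns M (par M Y). chan M Y p = h (restrict p Q)))"


section \<open>Structural equations\<close>

text \<open>
  A distribution \<open>D\<close> solves the structural equations under \<open>do(Z = z)\<close> if it is the law of a random
  assignment \<open>X\<close> with \<open>X\<^sub>Z = z\<close> and \<open>X\<^sub>Y = g\<^sub>Y(X\<^bsub>par(Y)\<^esub>, U\<^sub>Y)\<close> almost surely for all other nodes \<open>Y\<close>,
  where the noises \<open>U\<^sub>Y\<close> are independent of each other and the random map \<open>p \<mapsto> g\<^sub>Y(p, U\<^sub>Y)\<close> implements
  the channel of \<open>Y\<close>. In the presence of cycles \<open>U\<^sub>Y\<close> need not be independent of the parents of \<open>Y\<close>,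
  so the conditional distribution of \<open>Y\<close> given its parents can differ from the channel. Noises and
  sample space are real without loss of generality, since the nodes have countably many values.
\<close>

definition solves ::
  "('n, 'v) causal_model \<Rightarrow> 'n set \<Rightarrow> ('n \<Rightarrow> 'v) \<Rightarrow> ('n \<Rightarrow> 'v) pmf \<Rightarrow> bool" where
  "solves M Z z D \<longleftrightarrow>
     set_pmf D \<subseteq> {s \<in> assigns M (nodes M). \<forall>i\<in>Z. s i = z i} \<and>
     (\<exists>(\<Omega> :: real measure) (X :: real \<Rightarrow> 'n \<Rightarrow> 'v) (U :: 'n \<Rightarrow> real \<Rightarrow> real)
        (g :: 'n \<Rightarrow> ('n \<Rightarrow> 'v) \<Rightarrow> real \<Rightarrow> 'v).
        prob_space \<Omega> \<and>
        X \<in> measurable \<Omega> (count_space UNIV) \<and>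
        distr \<Omega> (count_space UNIV) X = measure_pmf D \<and>
        prob_space.indep_vars \<Omega> (\<lambda>_. borel) U (nodes M - Z) \<and>
        (\<forall>Y\<in>nodes M - Z. \<forall>p\<in>assigns M (par M Y).
           g Y p \<in> measurable borel (count_space UNIV) \<and>
           distr \<Omega> (count_space UNIV) (\<lambda>\<omega>. g Y p (U Y \<omega>)) = measure_pmf (chan M Y p)) \<and>
        (AE \<omega> in \<Omega>. \<forall>Y\<in>nodes M - Z. X \<omega> Y = g Y (restrict (X \<omega>) (par M Y)) (U Y \<omega>)))"

definition structural_equations :: "('n, 'v) causal_model \<Rightarrow> bool" where
  "structural_equations M \<longleftrightarrow>
     (\<forall>Z z. Z \<subseteq> nodes M \<and> z \<in> assigns M Z \<longrightarrow> solves M Z z (dist M Z z))"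


section \<open>Compatibility with the causal structure\<close>

text \<open>
  A path consists of its list of nodes and, for each step, whether the edge used points forward. The
  directions have to be recorded since both \<open>(a, b)\<close> and \<open>(b, a)\<close> may be edges.
\<close>

definition is_path :: "('a \<times> 'a) set \<Rightarrow> 'a list \<Rightarrow> bool list \<Rightarrow> bool" where
  "is_path E ns ds \<longleftrightarrow>
     length ns = Suc (length ds) \<and> distinct ns \<and>
     (\<forall>k<length ds. (if ds ! k then (ns ! k, ns ! Suc k) else (ns ! Suc k, ns ! k)) \<in> E)"

definition blocked :: "('a \<times> 'a) set \<Rightarrow> 'a set \<Rightarrow> 'a list \<Rightarrow> bool list \<Rightarrow> bool" where
  "blocked E C ns ds \<longleftrightarrow>
     (\<exists>k. Suc k < length ds \<and>
        (if ds ! k \<and> \<not> ds ! Suc k then E\<^sup>* `` {ns ! Suc k} \<inter> C = {} else ns ! Suc k \<in> C))"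

definition d_separated :: "('a \<times> 'a) set \<Rightarrow> 'a set \<Rightarrow> 'a set \<Rightarrow> 'a set \<Rightarrow> bool" where
  "d_separated E A B C \<longleftrightarrow>
     (\<forall>ns ds. is_path E ns ds \<and> hd ns \<in> A \<and> last ns \<in> B \<longrightarrow> blocked E C ns ds)"

text \<open>Written without division, so that conditions of probability zero impose nothing.\<close>

definition cond_indep :: "('a \<Rightarrow> 'b) pmf \<Rightarrow> 'a set \<Rightarrow> 'a set \<Rightarrow> 'a set \<Rightarrow> bool" where
  "cond_indep P A B C \<longleftrightarrow>
     (\<forall>t. let pr = (\<lambda>D. measure_pmf.prob P {s. \<forall>a\<in>D. s a = t a})
          in pr (A \<union> B \<union> C) * pr C = pr (A \<union> C) * pr (B \<union> C))"

text \<open>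
  Every node has an exogenous intervention variable, whose value is \<open>None\<close> if it is idle and \<open>Some v\<close>
  if it sets the node to \<open>v\<close>. Nodes in \<open>Z\<close> have no other parent, and their intervention variables
  are never idle; those of the remaining nodes may or may not be idle. The intervention variables are
  chosen freely, that is, with arbitrary independent distributions \<open>q\<close>.
\<close>

datatype 'n aug_node = Obs 'n | Intv 'n

definition aug_nodes :: "('n, 'v) causal_model \<Rightarrow> 'n aug_node set" where
  "aug_nodes M = Obs ` nodes M \<union> Intv ` nodes M"

definition aug_edges :: "('n, 'v) causal_model \<Rightarrow> 'n set \<Rightarrow> ('n aug_node \<times> 'n aug_node) set" where
  "aug_edges M Z =
     {(Obs i, Obs j) | i j. (i, j) \<in> edges M \<and> j \<notin> Z} \<union> {(Intv i, Obs i) | i. i \<in> nodes M}"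

definition aug_dist ::
  "('n, 'v) causal_model \<Rightarrow> ('n \<Rightarrow> 'v option pmf) \<Rightarrow> ('n aug_node \<Rightarrow> 'v option) pmf" where
  "aug_dist M q =
     bind_pmf (Pi_pmf (nodes M) None q) (\<lambda>\<iota>.
       map_pmf (\<lambda>s a. case a of Obs i \<Rightarrow> Some (s i) | Intv i \<Rightarrow> \<iota> i)
         (dist M (dom \<iota>) (restrict (the \<circ> \<iota>) (dom \<iota>))))"

definition d_sep_compatible :: "('n, 'v) causal_model \<Rightarrow> bool" where
  "d_sep_compatible M \<longleftrightarrow>
     (\<forall>Z q A B C.
        Z \<subseteq> nodes M \<and>
        (\<forall>i\<in>nodes M. set_pmf (q i) \<subseteq> insert None (Some ` vals M i)) \<and>
        (\<forall>i\<in>Z. None \<notin> set_pmf (q i)) \<and>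
        A \<subseteq> aug_nodes M \<and> B \<subseteq> aug_nodes M \<and> C \<subseteq> aug_nodes M \<and>
        A \<inter> B = {} \<and> A \<inter> C = {} \<and> B \<inter> C = {} \<and>
        d_separated (aug_edges M Z) A B C
        \<longrightarrow> cond_indep (aug_dist M q) A B C)"

definition structural_causal_model :: "('n, 'v) causal_model \<Rightarrow> bool" where
  "structural_causal_model M \<longleftrightarrow>
     well_formed M \<and> genuine_parents M \<and> structural_equations M \<and> d_sep_compatible M"


section \<open>Affects relations\<close>

definition affects :: "('n, 'v) causal_model \<Rightarrow> 'n set \<Rightarrow> 'n set \<Rightarrow> 'n set \<Rightarrow> bool" where
  "affects M X Y Z \<longleftrightarrow>
     (\<exists>x\<in>assigns M X. \<exists>z\<in>assigns M Z.
        map_pmf (\<lambda>s. restrict s Y) (dist M (X \<union> Z) (merge X Z (x, z))) \<noteq>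
        map_pmf (\<lambda>s. restrict s Y) (dist M Z z))"

definition irreducible_affects :: "('n, 'v) causal_model \<Rightarrow> 'n set \<Rightarrow> 'n set \<Rightarrow> 'n set \<Rightarrow> bool" where
  "irreducible_affects M X Y Z \<longleftrightarrow>
     affects M X Y Z \<and> (\<forall>sX. sX \<noteq> {} \<and> sX \<subset> X \<longrightarrow> affects M sX Y (Z \<union> (X - sX)))"

definition admissible :: "'n set \<Rightarrow> ('n set \<times> 'n set \<times> 'n set) set" where
  "admissible S =
     {(X, Y, Z). X \<subseteq> S \<and> Y \<subseteq> S \<and> Z \<subseteq> S \<and> X \<inter> Y = {} \<and> X \<inter> Z = {} \<and> Y \<inter> Z = {} \<and>
        X \<noteq> {} \<and> Y \<noteq> {}}"

definition affects_relations ::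
  "('n, 'v) causal_model \<Rightarrow> ('n set \<times> 'n set \<times> 'n set) set" where
  "affects_relations M = {(X, Y, Z) \<in> admissible (nodes M). affects M X Y Z}"

definition irreducible_affects_relations ::
  "('n, 'v) causal_model \<Rightarrow> ('n set \<times> 'n set \<times> 'n set) set" where
  "irreducible_affects_relations M =
     {(X, Y, Z) \<in> admissible (nodes M). irreducible_affects M X Y Z}"

definition singleton_affects_relations ::
  "('n, 'v) causal_model \<Rightarrow> ('n set \<times> 'n set \<times> 'n set) set" where
  "singleton_affects_relations M = {(X, Y, Z) \<in> affects_relations M. card X = 1 \<and> card Y = 1}"

end

theory Submission
  imports Defs
begin

text \<open>
  Nodes \<open>X \<noteq> Y\<close> are joined by an edge \<open>X \<rightarrow> Y\<close> iff \<open>X\<close> affects \<open>Y\<close> given \<open>do(S - {X, Y})\<close>. If there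
  is such an edge and the affects relation fails, then the channel of \<open>Y\<close>, which is the law of \<open>Y\<close>
  when all other nodes are set, does not depend on the value of \<open>X\<close>, contradicting the genuineness of
  the parent \<open>X\<close>. If there is no such edge, every path that leaves the intervention variable of \<open>X\<close>
  gets stuck at a collider in \<open>X\<close>, so this variable is independent of \<open>Y\<close>. Choosing it to be idle with
  probability \<open>1/2\<close> shows that \<open>Y\<close> has the same law whether or not \<open>X\<close> is set.
\<close>

section \<open>Edges yield affects relations\<close>

lemma map_pmf_restrict_singleton_eq_iff:
  "map_pmf (\<lambda>s. restrict s {y}) D = map_pmf (\<lambda>s. restrict s {y}) D' \<longleftrightarrow>
     map_pmf (\<lambda>s. s y) D = map_pmf (\<lambda>s. s y) D'"
proof
  assume "map_pmf (\<lambda>s. restrict s {y}) D = map_pmf (\<lambda>s. restrict s {y}) D'"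
  then have "map_pmf (\<lambda>f. f y) (map_pmf (\<lambda>s. restrict s {y}) D) =
      map_pmf (\<lambda>f. f y) (map_pmf (\<lambda>s. restrict s {y}) D')"
    by simp
  then show "map_pmf (\<lambda>s. s y) D = map_pmf (\<lambda>s. s y) D'"
    by (simp add: pmf.map_comp o_def)
next
  have eq: "map_pmf (\<lambda>s. restrict s {y}) E = map_pmf (\<lambda>v. restrict (\<lambda>_. v) {y}) (map_pmf (\<lambda>s. s y) E)"
    for E :: "('a \<Rightarrow> 'b) pmf"
    by (auto simp: pmf.map_comp fun_eq_iff restrict_def intro!: map_pmf_cong)
  assume "map_pmf (\<lambda>s. s y) D = map_pmf (\<lambda>s. s y) D'"
  then show "map_pmf (\<lambda>s. restrict s {y}) D = map_pmf (\<lambda>s. restrict s {y}) D'"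
    by (simp only: eq)
qed

lemma affects_singleton_target:
  "affects M X {Y} Z \<longleftrightarrow>
     (\<exists>x\<in>assigns M X. \<exists>z\<in>assigns M Z.
        map_pmf (\<lambda>s. s Y) (dist M (X \<union> Z) (merge X Z (x, z))) \<noteq> map_pmf (\<lambda>s. s Y) (dist M Z z))"
  by (simp add: affects_def map_pmf_restrict_singleton_eq_iff)

lemma par_subset:
  assumes "well_formed M"
  shows "par M Y \<subseteq> nodes M - {Y}"
  using assms unfolding well_formed_def par_def irrefl_def by auto

text \<open>The parents of \<open>Y\<close> are among the nodes that are set, so they are almost
  surely constant and the equation of \<open>Y\<close> has the noise \<open>U Y\<close> as its sole
  random input. A dependence between noise and parents, which cycles may cause, is thereby
  excluded.\<close>

lemma solves_all_but_one:
  assumes sol: "solves M (nodes M - {Y}) w D" and wf: "well_formed M" and Y: "Y \<in> nodes M"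
    and w: "w \<in> assigns M (nodes M - {Y})"
  shows "map_pmf (\<lambda>s. s Y) D = chan M Y (restrict w (par M Y))"
proof -
  obtain \<Omega> :: "real measure" and X :: "real \<Rightarrow> 'a \<Rightarrow> 'b" and U :: "'a \<Rightarrow> real \<Rightarrow> real" and g
    where "prob_space \<Omega>"
      and X: "X \<in> measurable \<Omega> (count_space UNIV)"
      and D: "distr \<Omega> (count_space UNIV) X = measure_pmf D"
      and indep: "prob_space.indep_vars \<Omega> (\<lambda>_. borel) U (nodes M - (nodes M - {Y}))"
      and g: "\<forall>Y\<in>nodes M - (nodes M - {Y}). \<forall>p\<in>assigns M (par M Y).
           g Y p \<in> measurable borel (count_space UNIV) \<and>
           distr \<Omega> (count_space UNIV) (\<lambda>\<omega>. g Y p (U Y \<omega>)) = measure_pmf (chan M Y p)"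
      and AE: "AE \<omega> in \<Omega>. \<forall>Y\<in>nodes M - (nodes M - {Y}).
           X \<omega> Y = g Y (restrict (X \<omega>) (par M Y)) (U Y \<omega>)"
    using sol unfolding solves_def by (elim conjE exE) rule
  interpret prob_space \<Omega> by fact
  define p where "p = restrict w (par M Y)"
  have par: "par M Y \<subseteq> nodes M - {Y}"
    by (rule par_subset[OF wf])
  have p: "p \<in> assigns M (par M Y)"
    unfolding p_def using w par by (auto simp: PiE_iff)
  have gY: "g Y p \<in> measurable borel (count_space UNIV)"
    and chan: "distr \<Omega> (count_space UNIV) (\<lambda>\<omega>. g Y p (U Y \<omega>)) = measure_pmf (chan M Y p)"
    using g p Y by auto
  \<comment> \<open>Measurability of each noise is part of \<open>indep_vars\<close>.\<close>
  have UY: "U Y \<in> borel_measurable \<Omega>"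
    using indep Y unfolding indep_vars_def by auto
  have set_D: "set_pmf D \<subseteq> {s. \<forall>i\<in>nodes M - {Y}. s i = w i}"
    using sol unfolding solves_def by auto
  have "AE s in measure_pmf D. \<forall>i\<in>nodes M - {Y}. s i = w i"
    using set_D by (auto simp: AE_measure_pmf_iff)
  then have "AE \<omega> in \<Omega>. \<forall>i\<in>nodes M - {Y}. X \<omega> i = w i"
    unfolding D[symmetric] by (subst (asm) AE_distr_iff[OF X]) auto
  with AE have *: "AE \<omega> in \<Omega>. X \<omega> Y = g Y p (U Y \<omega>)"
  proof eventually_elim
    case (elim \<omega>)
    have "restrict (X \<omega>) (par M Y) = p"
      unfolding p_def using elim(2) par by (intro restrict_ext) auto
    with elim(1) Y show ?case by auto
  qed
  have X_Y: "(\<lambda>\<omega>. X \<omega> Y) \<in> measurable \<Omega> (count_space UNIV)"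
    by (rule measurable_compose[OF X]) simp
  have "measure_pmf (map_pmf (\<lambda>s. s Y) D) = distr (measure_pmf D) (count_space UNIV) (\<lambda>s. s Y)"
    by (rule map_pmf_rep_eq)
  also have "\<dots> = distr \<Omega> (count_space UNIV) (\<lambda>\<omega>. X \<omega> Y)"
    unfolding D[symmetric] by (subst distr_distr[OF _ X]) (auto simp: o_def)
  also have "\<dots> = distr \<Omega> (count_space UNIV) (\<lambda>\<omega>. g Y p (U Y \<omega>))"
    by (rule distr_cong_AE[OF refl refl * X_Y measurable_compose[OF UY gY]])
  also have "\<dots> = measure_pmf (chan M Y p)"
    by (rule chan)
  finally show ?thesis
    by (simp add: p_def measure_pmf_inject)
qed

text \<open>The law of \<open>Y\<close> under do(Z) alone makes no reference to a value of
  \<open>X\<close>. If also setting \<open>X\<close> never changed this law, it would express the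
  channel of \<open>Y\<close> as a function of the parents other than \<open>X\<close>.\<close>

lemma edge_imp_affects:
  assumes scm: "structural_causal_model M" and edge: "(X, Y) \<in> edges M"
  shows "affects M {X} {Y} (nodes M - {X, Y})"
proof (rule ccontr)
  assume no_affects: "\<not> ?thesis"
  define Z where "Z = nodes M - {X, Y}"
  have wf: "well_formed M" and genuine: "genuine_parents M" and eqns: "structural_equations M"
    using scm unfolding structural_causal_model_def by auto
  have X: "X \<in> nodes M" and Y: "Y \<in> nodes M" and "X \<noteq> Y"
    using wf edge unfolding well_formed_def irrefl_def by auto
  have par: "par M Y \<subseteq> nodes M - {Y}"
    by (rule par_subset[OF wf])
  have XZ: "{X} \<union> Z = nodes M - {Y}"
    using X \<open>X \<noteq> Y\<close> unfolding Z_def by auto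
  have "\<forall>i\<in>nodes M. \<exists>v. v \<in> vals M i"
    using wf unfolding well_formed_def by auto
  then obtain d where d: "\<And>i. i \<in> nodes M \<Longrightarrow> d i \<in> vals M i"
    by metis
  \<comment> \<open>An assignment of the other parents is padded to one of all of \<open>Z\<close>;
    \<open>d\<close> supplies arbitrary values at the non-parents.\<close>
  define ext where "ext q = restrict (\<lambda>i. if i \<in> par M Y - {X} then q i else d i) Z" for q
  have "chan M Y p = map_pmf (\<lambda>s. s Y) (dist M Z (ext (restrict p (par M Y - {X}))))"
    if p: "p \<in> assigns M (par M Y)" for p
  proof -
    define x where "x = restrict p {X}"
    define z where "z = ext (restrict p (par M Y - {X}))"
    have "X \<in> par M Y"
      using edge unfolding par_def by simp
    then have x: "x \<in> assigns M {X}"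
      unfolding x_def using p by (auto simp: PiE_iff)
    have z: "z \<in> assigns M Z"
      unfolding z_def ext_def using p d by (auto simp: PiE_iff Z_def)
    have w: "merge {X} Z (x, z) \<in> assigns M (nodes M - {Y})"
      unfolding XZ[symmetric] using x z by (auto simp: PiE_iff merge_def extensional_def)
    \<comment> \<open>\<open>X\<close> gets its value from \<open>x\<close>, the other parents get
      theirs from \<open>z\<close>, and the padding by \<open>d\<close> lies outside
      \<open>par M Y\<close>.\<close>
    have "restrict (merge {X} Z (x, z)) (par M Y) = p"
    proof
      fix i
      show "restrict (merge {X} Z (x, z)) (par M Y) i = p i"
        using p par by (auto simp: merge_def x_def z_def ext_def Z_def PiE_iff extensional_def)
    qed
    moreover have "solves M (nodes M - {Y}) (merge {X} Z (x, z)) (dist M (nodes M - {Y}) (merge {X} Z (x, z)))"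
      using eqns w unfolding structural_equations_def by blast
    ultimately have "chan M Y p = map_pmf (\<lambda>s. s Y) (dist M ({X} \<union> Z) (merge {X} Z (x, z)))"
      using solves_all_but_one[OF _ wf Y w] unfolding XZ by metis
    also have "\<dots> = map_pmf (\<lambda>s. s Y) (dist M Z z)"
      using no_affects x z unfolding affects_singleton_target Z_def by blast
    finally show ?thesis
      by (simp add: z_def)
  qed
  then have "\<exists>h. \<forall>p\<in>assigns M (par M Y). chan M Y p = h (restrict p (par M Y - {X}))"
    by (intro exI[of _ "\<lambda>q. map_pmf (\<lambda>s. s Y) (dist M Z (ext q))"]) auto
  moreover have "par M Y - {X} \<subset> par M Y"
    using edge unfolding par_def by auto
  ultimately show False
    using genuine Y unfolding genuine_parents_def by blast
qed

section \<open>Missing edges exclude affects relations\<close>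

text \<open>With the edges into all nodes except \<open>X\<close> and \<open>Y\<close> removed,
  \<open>Obs X\<close> has no outgoing edge, as loops and the edge to \<open>Y\<close> are excluded.
  A path from \<open>Intv X\<close> thus leaves \<open>Obs X\<close> against an edge, and this
  collider blocks it because nothing is conditioned on.\<close>

lemma d_separated_intervention:
  assumes "irrefl (edges M)" and "edges M \<subseteq> nodes M \<times> nodes M"
    and "(X, Y) \<notin> edges M" and "X \<noteq> Y"
  shows "d_separated (aug_edges M (nodes M - {X, Y})) {Intv X} {Obs Y} {}"
  unfolding d_separated_def
proof (intro allI impI)
  fix ns ds
  let ?E = "aug_edges M (nodes M - {X, Y})"
  assume "is_path ?E ns ds \<and> hd ns \<in> {Intv X} \<and> last ns \<in> {Obs Y}"
  then have len: "length ns = Suc (length ds)"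
    and step: "\<And>k. k < length ds \<Longrightarrow>
      (if ds ! k then (ns ! k, ns ! Suc k) else (ns ! Suc k, ns ! k)) \<in> ?E"
    and hd: "hd ns = Intv X" and last: "last ns = Obs Y"
    unfolding is_path_def by auto
  have "ns \<noteq> []"
    using len by auto
  then have ns0: "ns ! 0 = Intv X" and nsl: "ns ! length ds = Obs Y"
    using len hd last hd_conv_nth[of ns] last_conv_nth[of ns] by simp_all
  have "0 < length ds"
    using ns0 nsl by (cases ds) auto
  \<comment> \<open>\<open>Intv X\<close> has no incoming edge, and its one outgoing edge leads to
    \<open>Obs X\<close>.\<close>
  with step[of 0] ns0 have step0: "ds ! 0" and ns1: "ns ! Suc 0 = Obs X"
    by (auto simp: aug_edges_def split: if_splits)
  have "length ds \<noteq> Suc 0"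
    using ns1 nsl \<open>X \<noteq> Y\<close> by auto
  then have len2: "Suc 0 < length ds"
    using \<open>0 < length ds\<close> by linarith
  have "\<not> ds ! Suc 0"
    using step[OF len2] ns1 assms by (auto simp: aug_edges_def irrefl_def split: if_splits)
  then show "blocked ?E {} ns ds"
    unfolding blocked_def using step0 len2 by (intro exI[of _ 0]) simp
qed

text \<open>All intervention variables except that of \<open>X\<close> are deterministic, so the
  mixture over interventions reduces to one fair coin. \<open>F\<close> is described just at the
  coordinates that the independence argument reads.\<close>

lemma aug_dist_coin:
  fixes M :: "('n, 'v) causal_model"
  assumes "finite (nodes M)" and X: "X \<in> nodes M" and "Z \<subseteq> nodes M" and "X \<notin> Z"
    and x: "x \<in> extensional {X}" and z: "z \<in> extensional Z"
  defines "q \<equiv> \<lambda>i. if i = X then map_pmf (\<lambda>b. if b then Some (x X) else None) (bernoulli_pmf (1/2))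
    else return_pmf (if i \<in> Z then Some (z i) else None)"
  shows "\<exists>F :: bool \<Rightarrow> ('n \<Rightarrow> 'v) \<Rightarrow> 'n aug_node \<Rightarrow> 'v option.
    aug_dist M q = bind_pmf (bernoulli_pmf (1/2)) (\<lambda>b. map_pmf (F b)
      (if b then dist M ({X} \<union> Z) (merge {X} Z (x, z)) else dist M Z z)) \<and>
    (\<forall>b s. F b s (Intv X) = (if b then Some (x X) else None)) \<and> (\<forall>b s i. F b s (Obs i) = Some (s i))"
proof -
  define \<iota> where "\<iota> b i = (if i = X then if b then Some (x X) else None else if i \<in> Z then Some (z i) else None)"
    for b i
  have nodes: "nodes M = insert X (nodes M - {X})"
    using X by auto
  have "Pi_pmf (nodes M - {X}) None q =
      Pi_pmf (nodes M - {X}) None (\<lambda>i. return_pmf (if i \<in> Z then Some (z i) else None))"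
    by (intro Pi_pmf_cong) (auto simp: q_def)
  \<comment> \<open>The default \<open>None\<close> of \<open>Pi_pmf\<close>, taken at
    \<open>X\<close> and outside the nodes, agrees with the idle value in
    \<open>\<iota> False\<close>.\<close>
  also have "\<dots> = return_pmf (\<iota> False)"
    using assms(1,3,4) by (subst Pi_pmf_return_pmf) (auto simp: \<iota>_def fun_eq_iff)
  finally have rest: "Pi_pmf (nodes M - {X}) None q = return_pmf (\<iota> False)" .
  have "Pi_pmf (nodes M) None q =
      map_pmf (\<lambda>(a, f). f(X := a)) (pair_pmf (q X) (Pi_pmf (nodes M - {X}) None q))"
    using assms(1) by (subst nodes, subst Pi_pmf_insert) auto
  also have "\<dots> = map_pmf \<iota> (bernoulli_pmf (1/2))"
    unfolding rest pair_return_pmf2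
    by (auto simp: q_def pmf.map_comp o_def \<iota>_def fun_eq_iff intro!: map_pmf_cong)
  finally have Pi: "Pi_pmf (nodes M) None q = map_pmf \<iota> (bernoulli_pmf (1/2))" .
  have dom: "dom (\<iota> b) = (if b then {X} \<union> Z else Z)" for b
    using assms(4) by (auto simp: \<iota>_def dom_def split: if_splits)
  have val: "restrict (the \<circ> \<iota> b) (dom (\<iota> b)) = (if b then merge {X} Z (x, z) else z)" for b
    unfolding dom using assms(4) x z by (auto simp: \<iota>_def fun_eq_iff merge_def extensional_def)
  have dist: "dist M (dom (\<iota> b)) (restrict (the \<circ> \<iota> b) (dom (\<iota> b))) =
      (if b then dist M ({X} \<union> Z) (merge {X} Z (x, z)) else dist M Z z)" for b
    by (simp only: val) (simp add: dom)
  show ?thesis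
    unfolding aug_dist_def Pi bind_map_pmf dist
    by (intro exI[of _ "\<lambda>b s a. case a of Obs i \<Rightarrow> Some (s i) | Intv i \<Rightarrow> \<iota> b i"]) (auto simp: \<iota>_def)
qed

lemma measure_bind_fair_coin:
  "measure_pmf.prob (bind_pmf (bernoulli_pmf (1/2)) f) A =
     (measure_pmf.prob (f True) A + measure_pmf.prob (f False) A) / 2"
proof -
  \<comment> \<open>As the mass of a Boolean distribution at \<open>True\<close>, the probability of
    an event can be computed by \<open>pmf_bind\<close>.\<close>
  have "measure_pmf.prob D A = pmf (map_pmf (\<lambda>s. s \<in> A) D) True" for D
    by (simp add: pmf_map vimage_def)
  then show ?thesis
    by (simp add: map_bind_pmf pmf_bind field_simps)
qed

text \<open>Let u and v be the probabilities of \<open>Y\<close> having value y with and without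
  setting \<open>X\<close>. Independence of this event from the coin showing idle reads v/2 = (1/2)
  * (u + v)/2, whence u = v.\<close>

lemma not_edge_imp_not_affects:
  fixes M :: "('n, 'v) causal_model"
  assumes scm: "structural_causal_model M" and X: "X \<in> nodes M" and Y: "Y \<in> nodes M" and "X \<noteq> Y"
    and no_edge: "(X, Y) \<notin> edges M"
  shows "\<not> affects M {X} {Y} (nodes M - {X, Y})"
proof -
  define Z where "Z = nodes M - {X, Y}"
  have wf: "well_formed M" and compat: "d_sep_compatible M"
    using scm unfolding structural_causal_model_def by auto
  have "map_pmf (\<lambda>s. s Y) (dist M ({X} \<union> Z) (merge {X} Z (x, z))) = map_pmf (\<lambda>s. s Y) (dist M Z z)"
    if x: "x \<in> assigns M {X}" and z: "z \<in> assigns M Z" for x z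
  proof (rule pmf_eqI)
    fix y :: 'v
    define D1 where "D1 = dist M ({X} \<union> Z) (merge {X} Z (x, z))"
    define D0 where "D0 = dist M Z z"
    define q where "q = (\<lambda>i. if i = X then map_pmf (\<lambda>b. if b then Some (x X) else None) (bernoulli_pmf (1/2))
      else return_pmf (if i \<in> Z then Some (z i) else None))"
    obtain F :: "bool \<Rightarrow> ('n \<Rightarrow> 'v) \<Rightarrow> 'n aug_node \<Rightarrow> 'v option"
      where aug: "aug_dist M q = bind_pmf (bernoulli_pmf (1/2)) (\<lambda>b. map_pmf (F b) (if b then D1 else D0))"
        and F_Intv: "\<And>b s. F b s (Intv X) = (if b then Some (x X) else None)"
        and F_Obs: "\<And>b s i. F b s (Obs i) = Some (s i)"
      using aug_dist_coin[of M X Z x z] wf X x z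
      unfolding q_def[symmetric] D1_def[symmetric] D0_def[symmetric]
      by (auto simp: well_formed_def Z_def PiE_def)
    have "d_separated (aug_edges M Z) {Intv X} {Obs Y} {}"
      unfolding Z_def using wf no_edge \<open>X \<noteq> Y\<close>
      by (intro d_separated_intervention) (auto simp: well_formed_def)
    moreover have "\<forall>i\<in>nodes M. set_pmf (q i) \<subseteq> insert None (Some ` vals M i)"
      using x z by (auto simp: q_def PiE_iff)
    \<comment> \<open>The coin concerns \<open>X\<close>, which lies outside \<open>Z\<close>; nodes
      in \<open>Z\<close> are always set, which justifies deleting their incoming edges.\<close>
    moreover have "\<forall>i\<in>Z. None \<notin> set_pmf (q i)"
      by (auto simp: q_def Z_def)
    ultimately have indep: "cond_indep (aug_dist M q) {Intv X} {Obs Y} {}"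
      using compat X Y unfolding d_sep_compatible_def aug_nodes_def
      by (elim allE[where x = Z] allE[where x = q] allE[where x = "{Intv X}"]
          allE[where x = "{Obs Y}"] allE[where x = "{}"]) (auto simp: Z_def)
    \<comment> \<open>The events tested are that \<open>Intv X\<close> is idle and that
      \<open>Y\<close> takes the value \<open>y\<close>.\<close>
    define t where "t a = (case a of Intv i \<Rightarrow> None | Obs i \<Rightarrow> Some y)" for a :: "'n aug_node"
    define pr where "pr A = measure_pmf.prob (aug_dist M q) {s. \<forall>a\<in>A. s a = t a}" for A
    have "pr ({Intv X} \<union> {Obs Y} \<union> {}) * pr {} = pr ({Intv X} \<union> {}) * pr ({Obs Y} \<union> {})"
      using indep unfolding cond_indep_def pr_def Let_def by blast
    moreover have "pr {} = 1"
      by (simp add: pr_def)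
    moreover have "pr {Intv X} = 1/2"
      unfolding pr_def aug measure_bind_fair_coin by (simp add: t_def F_Intv vimage_def)
    moreover have "pr {Obs Y} = (pmf (map_pmf (\<lambda>s. s Y) D1) y + pmf (map_pmf (\<lambda>s. s Y) D0) y) / 2"
      unfolding pr_def aug measure_bind_fair_coin by (simp add: t_def F_Obs vimage_def pmf_map)
    moreover have "pr {Intv X, Obs Y} = pmf (map_pmf (\<lambda>s. s Y) D0) y / 2"
      unfolding pr_def aug measure_bind_fair_coin by (simp add: t_def F_Intv F_Obs vimage_def pmf_map)
    ultimately have "pmf (map_pmf (\<lambda>s. s Y) D1) y = pmf (map_pmf (\<lambda>s. s Y) D0) y"
      by (simp add: insert_commute)
    then show "pmf (map_pmf (\<lambda>s. s Y) (dist M ({X} \<union> Z) (merge {X} Z (x, z)))) y =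
        pmf (map_pmf (\<lambda>s. s Y) (dist M Z z)) y"
      by (simp add: D1_def D0_def)
  qed
  then show ?thesis
    unfolding affects_singleton_target Z_def by blast
qed

section \<open>Reconstruction of the causal structure\<close>

lemma edge_iff_affects:
  assumes scm: "structural_causal_model M"
  shows "(X, Y) \<in> edges M \<longleftrightarrow> ({X}, {Y}, nodes M - {X, Y}) \<in> affects_relations M"
proof -
  have "(X, Y) \<in> edges M \<Longrightarrow> X \<in> nodes M \<and> Y \<in> nodes M \<and> X \<noteq> Y"
    using scm unfolding structural_causal_model_def well_formed_def irrefl_def by auto
  then show ?thesis
    using edge_imp_affects[OF scm] not_edge_imp_not_affects[OF scm]
    unfolding affects_relations_def admissible_def by auto
qed

lemma irreducible_affects_singleton: "irreducible_affects M {X} Y Z \<longleftrightarrow> affects M {X} Y Z"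
  unfolding irreducible_affects_def by (auto simp: psubset_eq subset_singleton_iff)

theorem lemma3p6:
  fixes S :: "'n set"
    and M :: "('n, 'v) causal_model"
    and M' :: "('n, 'w) causal_model"
  assumes "structural_causal_model M" and "nodes M = S"
    and "structural_causal_model M'" and "nodes M' = S"
  shows "(affects_relations M = affects_relations M' \<longrightarrow> edges M = edges M') \<and>
         (irreducible_affects_relations M = irreducible_affects_relations M' \<longrightarrow> edges M = edges M') \<and>
         (singleton_affects_relations M = singleton_affects_relations M' \<longrightarrow> edges M = edges M')"
proof -
  \<comment> \<open>The value type \<open>'u\<close> is generic since \<open>M\<close> and
    \<open>M'\<close> may have different types of values.\<close>
  have irreducible: "({X}, {Y}, Z) \<in> irreducible_affects_relations N \<longleftrightarrow> ({X}, {Y}, Z) \<in> affects_relations N"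
    for N :: "('n, 'u) causal_model" and X Y Z
    by (simp add: irreducible_affects_relations_def affects_relations_def irreducible_affects_singleton)
  have singleton: "({X}, {Y}, Z) \<in> singleton_affects_relations N \<longleftrightarrow> ({X}, {Y}, Z) \<in> affects_relations N"
    for N :: "('n, 'u) causal_model" and X Y Z
    by (simp add: singleton_affects_relations_def)
  \<comment> \<open>The edge criterion uses relations between single nodes, and all three
    collections agree on these.\<close>
  have edges: "edges M = edges M'"
    if "\<And>X Y Z. ({X}, {Y}, Z) \<in> affects_relations M \<longleftrightarrow> ({X}, {Y}, Z) \<in> affects_relations M'"
    by (simp add: set_eq_iff split_paired_all edge_iff_affects[OF assms(1)] edge_iff_affects[OF assms(3)]
        that assms(2,4))
  show ?thesis
  proof (intro conjI impI)
    assume "affects_relations M = affects_relations M'"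
    then show "edges M = edges M'"
      by (intro edges) simp
  next
    assume "irreducible_affects_relations M = irreducible_affects_relations M'"
    then show "edges M = edges M'"
      by (intro edges) (simp only: irreducible[symmetric])
  next
    assume "singleton_affects_relations M = singleton_affects_relations M'"
    then show "edges M = edges M'"
      by (intro edges) (simp only: singleton[symmetric])
  qed
qed

end
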